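(* The prime $3$ is the only prime which is both Mersenne and $2$-rooted.
   Context: A Mersenne prime is a prime of the form $2^n-1$ for some positive integer $n$. An odd prime $p$ is $2$-rooted if $2$ is a primitive root mod $p$, i.e. $2$ generates the multiplicative group of the field with $p$ elements. *)

theory Defs
  imports "HOL-Number_Theory.Number_Theory" "HOL-Algebra.Generated_Groups"
begin

definition mersenne_prime :: "nat \<Rightarrow> bool" where
  "mersenne_prime p \<longleftrightarrow> prime p \<and> (\<exists>n>0. p = 2 ^ n - 1)"

definition two_rooted :: "nat \<Rightarrow> bool" where
  "two_rooted p \<longleftrightarrow> prime p \<and> odd p \<and> residue_primroot p 2"

text \<open>
  The library's \<open>residue_primroot\<close> is phrased with the multiplicative order. For an odd prime
  it says that \<open>2\<close> generates the multiplicative group of the field with \<open>p\<close> elements.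
\<close>

lemma residue_primroot_2_iff_generate:
  assumes "prime p" "odd p"
  defines "G \<equiv> mult_of (residue_ring (int p))"
  shows "residue_primroot p 2 \<longleftrightarrow> generate G {2} = carrier G"
proof -
  interpret R: residues_prime p "residue_ring (int p)"
    by (simp add: residues_prime_def assms)
  interpret G: group G
    unfolding G_def by (rule R.field_mult_group)
  have p: "p > 2"
    using prime_ge_2_nat[OF assms(1)] assms(2) by (cases "p = 2") auto
  have carrier_G: "carrier G = {1..int p - 1}"
    unfolding G_def by (auto simp: R.res_carrier_eq R.res_zero_eq)
  have two: "2 \<in> carrier G"
    using p by (simp add: carrier_G)
  have coprime: "coprime p 2"
    using assms(2) by simp
  have pow: "2 [^]\<^bsub>G\<^esub> k = 2 ^ k mod int p" for k :: nat
    using R.pow_cong[of 2 k] p by (simp add: G_def nat_pow_mult_of)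
  have one_G: "\<one>\<^bsub>G\<^esub> = 1"
    by (simp add: G_def R.res_one_eq)
  have "2 [^]\<^bsub>G\<^esub> k = \<one>\<^bsub>G\<^esub> \<longleftrightarrow> [2 ^ k = 1] (mod p)" for k :: nat
  proof -
    have "2 [^]\<^bsub>G\<^esub> k = \<one>\<^bsub>G\<^esub> \<longleftrightarrow> [int (2 ^ k) = int 1] (mod int p)"
      using p by (simp add: pow one_G cong_def)
    thus ?thesis
      by (simp only: cong_int_iff)
  qed
  hence "G.ord 2 dvd k \<longleftrightarrow> ord p 2 dvd k" for k :: nat
    using G.pow_eq_id[OF two] ord_divides[of 2 k p] by metis
  hence ord_eq: "G.ord 2 = ord p 2"
    by (meson dvd_antisym dvd_refl)
  have card_G: "card (carrier G) = totient p"
    using assms(1) p by (simp add: carrier_G totient_prime nat_diff_distrib)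
  have sub: "generate G {2} \<subseteq> carrier G"
    using G.generate_incl two by simp
  have "residue_primroot p 2 \<longleftrightarrow> card (generate G {2}) = card (carrier G)"
    using p coprime G.generate_pow_card[OF two]
    by (simp add: residue_primroot_def ord_eq card_G)
  also have "\<dots> \<longleftrightarrow> generate G {2} = carrier G"
    using card_subset_eq[OF _ sub] by (auto simp: carrier_G)
  finally show ?thesis .
qed

end

theory Submission
  imports Defs
begin

text \<open>
  If \<open>p = 2 ^ n - 1\<close> then \<open>2 ^ n\<close> is congruent to \<open>1\<close> modulo \<open>p\<close>, so the order of \<open>2\<close>
  divides \<open>n\<close> and is only about the logarithm of \<open>p\<close> (\<open>ord_2_mersenne_le\<close>). A primitive root
  must instead have order \<open>p - 1 = 2 ^ n - 2\<close>. Hence \<open>2 ^ n - 2 \<le> n\<close>, and since exponential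
  growth beats linear growth from \<open>n = 3\<close> on (\<open>add_2_less_power_2\<close>), \<open>n \<le> 2\<close>. As \<open>n = 1\<close> gives
  the non-prime \<open>p = 1\<close>, only \<open>n = 2\<close> and \<open>p = 3\<close> remain. Conversely, \<open>2\<close> is \<open>-1\<close> modulo \<open>3\<close>,
  so its order is the full \<open>3 - 1 = 2\<close> (\<open>residue_primroot_3_2\<close>).
\<close>

lemma ord_2_mersenne_le:
  assumes "n > 0"
  shows "ord (2 ^ n - 1) (2 :: nat) \<le> n"
proof -
  have "[2 ^ n = 1] (mod (2 ^ n - 1 :: nat))"
    by (simp add: cong_altdef_nat)
  hence "ord (2 ^ n - 1) (2 :: nat) dvd n"
    by (simp only: ord_divides)
  thus ?thesis
    using assms by (rule dvd_imp_le)
qed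

lemma add_2_less_power_2:
  assumes "n \<ge> 3"
  shows "n + 2 < (2 :: nat) ^ n"
  using assms by (induction n rule: dec_induct) auto

lemma residue_primroot_3_2: "residue_primroot 3 2"
proof -
  have "ord 3 (2 :: nat) dvd 2" "\<not> ord 3 (2 :: nat) dvd 1"
    using ord_divides[of 2 2 3] ord_divides[of 2 1 3] by (simp_all add: cong_def)
  hence "ord 3 (2 :: nat) = 2"
    using prime_nat_iff[of 2] two_is_prime_nat by (metis dvd_refl)
  thus ?thesis
    by (simp add: residue_primroot_def totient_prime)
qed

theorem corollary1p3:
  fixes p :: nat
  shows "mersenne_prime p \<and> two_rooted p \<longleftrightarrow> p = 3"
proof
  assume "mersenne_prime p \<and> two_rooted p"
  then obtain n where n: "n > 0" "p = 2 ^ n - 1"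
    and p: "prime p" and root: "residue_primroot p 2"
    by (auto simp: mersenne_prime_def two_rooted_def)
  have "p - 1 = ord p 2"
    using root p by (simp add: residue_primroot_def totient_prime)
  also have "\<dots> \<le> n"
    using ord_2_mersenne_le n by simp
  finally have "2 ^ n \<le> n + 2"
    using n by simp
  hence "n < 3"
    using add_2_less_power_2[of n] by linarith
  moreover have "n \<noteq> 1"
    using p n by auto
  ultimately have "n = 2"
    using n by linarith
  thus "p = 3"
    using n by simp
next
  assume "p = 3"
  moreover have "\<exists>n>0. (3 :: nat) = 2 ^ n - 1"
    by (rule exI[of _ 2]) simp
  ultimately show "mersenne_prime p \<and> two_rooted p"
    using residue_primroot_3_2 by (simp add: mersenne_prime_def two_rooted_def)
qed

end
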